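(* For any integer $k\geq 1$, the middle levels graph $M_{2k+1}$ has a $\mathcal{C}_{4k+2}$-factor.
   Context: The middle levels graph $M_{2k+1}$ has as vertices all $k$-element and all $(k+1)$-element subsets of $\{1,2,\ldots,2k+1\}$, with an edge between two sets if one is a subset of the other. For a graph $G$ with $n$ vertices and a divisor $\ell$ of $n$, a $\mathcal{C}_\ell$-factor of $G$ is a collection of $n/\ell$ pairwise vertex-disjoint cycles in $G$, each of length $\ell$. *)

theory Defs
  imports "Graph_Theory.Graph_Theory"
begin

definition middle_levels :: "nat \<Rightarrow> nat set set" where
  "middle_levels k = {A. A \<subseteq> {1..2 * k + 1} \<and> (card A = k \<or> card A = k + 1)}"

definition middle_levels_graph :: "nat \<Rightarrow> nat set pair_pre_digraph" where
  "middle_levels_graph k =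
    \<lparr> pverts = middle_levels k,
      parcs = {(A, B). A \<in> middle_levels k \<and> B \<in> middle_levels k \<and> (A \<subset> B \<or> B \<subset> A)} \<rparr>"

text \<open>An undirected simple graph is a finite symmetric loop-free digraph,
  the locale \<^locale>\<open>pair_graph\<close>.\<close>

lemma finite_middle_levels: "finite (middle_levels k)"
  by (rule finite_subset[of _ "Pow {1..2 * k + 1}"]) (auto simp: middle_levels_def)

lemma pair_graph_middle_levels_graph: "pair_graph (middle_levels_graph k)"
proof
  show "finite (pverts (middle_levels_graph k))"
    by (simp add: middle_levels_graph_def finite_middle_levels)
  show "finite (parcs (middle_levels_graph k))"
    by (rule finite_subset[of _ "middle_levels k \<times> middle_levels k"])
      (auto simp: middle_levels_graph_def finite_middle_levels)
  show "symmetric (middle_levels_graph k)"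
    by (auto simp: middle_levels_graph_def symmetric_def intro!: symI)
qed (auto simp: middle_levels_graph_def)

text \<open>
  Cycles are closed walks given by their list of arcs. The library's \<^const>\<open>pre_digraph.cycle\<close>
  also accepts an edge traversed back and forth, hence the bound \<open>3 \<le> l\<close>.
  The vertices visited by a cycle are exactly the tails of its arcs.
  A cycle may be represented by any of its rotations and by either orientation, but pairwise
  disjointness of the vertex sets ensures that no cycle is counted twice.
\<close>

definition is_cycle_factor ::
    "'a pair_pre_digraph \<Rightarrow> nat \<Rightarrow> ('a \<times> 'a) list set \<Rightarrow> bool" where
  "is_cycle_factor G l C \<longleftrightarrow>
    3 \<le> l \<and> l dvd card (pverts G) \<and>
    finite C \<and> card C = card (pverts G) div l \<and>
    (\<forall>p\<in>C. pre_digraph.cycle G p \<and> length p = l) \<and>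
    (\<forall>p\<in>C. \<forall>q\<in>C. p \<noteq> q \<longrightarrow> fst ` set p \<inter> fst ` set q = {})"

definition has_cycle_factor :: "'a pair_pre_digraph \<Rightarrow> nat \<Rightarrow> bool" where
  "has_cycle_factor G l \<longleftrightarrow> (\<exists>C. is_cycle_factor G l C)"

end

theory Submission
  imports Defs
begin

text \<open>
  Each Dyck word \<open>d\<close> of length \<open>2k\<close> starts a path of words that flips every position exactly once,
  alternately \<open>1 \<rightarrow> 0\<close> and \<open>0 \<rightarrow> 1\<close>, and so ends in the complement \<open>d'\<close> of \<open>d\<close>. For \<open>d = 1 u 0 b\<close>
  one flips \<open>b\<close> along its own path, then the leading \<open>1\<close>, then \<open>u\<close> along its path with the order of
  flips reversed, and finally the \<open>0\<close> after \<open>u\<close>. First and last passage decompositions show that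
  these paths partition all words of length \<open>2k\<close> with \<open>k\<close> or \<open>k - 1\<close> ones. Following the path
  with a \<open>1\<close> appended, and then its complement with a \<open>0\<close> appended, closes up to a cycle
  of length \<open>2(2k + 1)\<close> in the middle levels graph, and these cycles partition its vertices.
\<close>

section \<open>Binary words\<close>

definition height :: "bool list \<Rightarrow> int" where
  "height w = (\<Sum>b\<leftarrow>w. if b then 1 else -1)"

abbreviation compl :: "bool list \<Rightarrow> bool list" where
  "compl \<equiv> map Not"

lemma height_simps [simp]:
  "height [] = 0"
  "height (b # w) = (if b then 1 else -1) + height w"
  "height (v @ w) = height v + height w"
  by (simp_all add: height_def)

lemma height_compl [simp]: "height (compl w) = - height w"
  by (induction w) auto

lemma height_rev [simp]: "height (rev w) = height w"
  by (induction w) auto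

lemma Not_comp_Not [simp]: "Not \<circ> Not = id"
  by auto

lemma compl_eq_iff [simp]: "compl v = compl w \<longleftrightarrow> v = w"
  by (simp add: inj_map_eq_map inj_def)

definition flip :: "bool list \<Rightarrow> bool list \<Rightarrow> bool" where
  "flip v w \<longleftrightarrow> (\<exists>a x c. v = a @ x # c \<and> w = a @ (\<not> x) # c)"

lemma flipI: "flip (a @ x # c) (a @ (\<not> x) # c)"
  by (auto simp: flip_def)

lemma flipE:
  assumes "flip v w"
  obtains a x c where "v = a @ x # c" "w = a @ (\<not> x) # c"
  using assms by (auto simp: flip_def)

lemma flip_sym: "flip v w \<Longrightarrow> flip w v"
  by (auto simp: flip_def)

lemma flip_append_left: "flip v w \<Longrightarrow> flip (a @ v) (a @ w)"
  by (erule flipE) (metis append_assoc flipI)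

lemma flip_Cons: "flip v w \<Longrightarrow> flip (x # v) (x # w)"
  using flip_append_left[of v w "[x]"] by simp

lemma flip_append_right: "flip v w \<Longrightarrow> flip (v @ c) (w @ c)"
  by (erule flipE) (metis append_Cons append_assoc flipI)

lemma flip_compl:
  assumes "flip v w"
  shows "flip (compl v) (compl w)"
proof -
  obtain a x c where "v = a @ x # c" "w = a @ (\<not> x) # c"
    using assms by (rule flipE)
  then show ?thesis
    using flipI[of "compl a" "\<not> x" "compl c"] by simp
qed

section \<open>Dyck words and first passage decomposition\<close>

text \<open>Dyck words are represented by binary trees through first return: \<open>Node u b\<close>
  stands for 1 u 0 b. Thus the decomposition is available by structural recursion, and
  \<open>size\<close> is half the length.\<close>

datatype tree = Tip | Node tree tree

primrec dyck :: "tree \<Rightarrow> bool list" where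
  "dyck Tip = []"
| "dyck (Node u b) = True # dyck u @ False # dyck b"

lemma height_dyck [simp]: "height (dyck t) = 0"
  by (induction t) auto

lemma length_dyck [simp]: "length (dyck t) = 2 * size t"
  by (induction t) auto

text \<open>The walk must step below level 0 at some point, and the part before the first such step
  is a Dyck word.\<close>

lemma first_passage_exists:
  "height w < 0 \<Longrightarrow> \<exists>t w'. w = dyck t @ False # w'"
proof (induction "length w" arbitrary: w rule: less_induct)
  case less
  show ?case
  proof (cases w)
    case Nil
    with less.prems show ?thesis by simp
  next
    case (Cons x v)
    show ?thesis
    proof (cases x)
      case False
      with Cons have "w = dyck Tip @ False # v" by simp
      then show ?thesis by blast
    next
      case True
      \<comment> \<open>Below -1 there is room for two passages: the first closes the leading
        \<open>True\<close>, the second is the one sought.\<close>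
      with Cons less.prems have v: "height v < -1" by simp
      then obtain t v' where t: "v = dyck t @ False # v'"
        using less.hyps[of v] Cons by auto
      with v have "height v' < 0" by simp
      then obtain s v'' where "v' = dyck s @ False # v''"
        using less.hyps[of v'] Cons t by auto
      with t Cons True have "w = dyck (Node t s) @ False # v''" by simp
      then show ?thesis by blast
    qed
  qed
qed

text \<open>The displayed \<open>False\<close> is the first step below level 0, so its position is
  determined by the word.\<close>

lemma first_passage_unique:
  "dyck s @ False # v = dyck t @ False # w \<longleftrightarrow> s = t \<and> v = w"
proof (induction s arbitrary: t v w)
  case Tip
  then show ?case by (cases t) auto
next
  case (Node u b)
  then show ?case by (cases t) auto
qed

lemma dyck_eq_iff [simp]: "dyck s = dyck t \<longleftrightarrow> s = t"
  using first_passage_unique[of s "[]" t "[]"] by auto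

text \<open>Appending \<open>False\<close> to both sides would give two first passage decompositions
  of one word, with remainders \<open>[]\<close> and \<open>w @ [False]\<close>.\<close>

lemma dyck_no_passage: "dyck s \<noteq> dyck t @ False # w"
  using first_passage_unique[of s "[]" t "w @ [False]"] by auto

section \<open>Last passage decomposition, by reflecting Dyck paths\<close>

primrec graft :: "tree \<Rightarrow> tree \<Rightarrow> tree" where
  "graft Tip c = c"
| "graft (Node u b) c = Node u (graft b c)"

lemma dyck_graft [simp]: "dyck (graft a c) = dyck a @ dyck c"
  by (induction a) auto

primrec mirror :: "tree \<Rightarrow> tree" where
  "mirror Tip = Tip"
| "mirror (Node u b) = graft (mirror b) (Node (mirror u) Tip)"

lemma dyck_mirror: "dyck (mirror t) = rev (compl (dyck t))"
  by (induction t) auto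

text \<open>A first passage of the reversed word, read backwards, is a last passage; the reversed
  Dyck word is the complement of a mirrored one.\<close>

lemma last_passage_exists:
  assumes "height w < 0"
  shows "\<exists>t w'. w = w' @ False # compl (dyck t)"
proof -
  obtain t v where "rev w = dyck t @ False # v"
    using first_passage_exists[of "rev w"] assms by auto
  then have "w = rev v @ False # rev (dyck t)"
    by (metis append.assoc append_Cons append_Nil rev.simps(2) rev_append rev_rev_ident)
  also have "rev (dyck t) = compl (dyck (mirror t))"
    by (simp add: dyck_mirror rev_map)
  finally show ?thesis by blast
qed

lemma dyck_or_last_passage:
  assumes "height r = 0"
  shows "(\<exists>t. r = dyck t) \<or> (\<exists>s t. r = s @ True # dyck t)"
proof -
  \<comment> \<open>The appended \<open>False\<close> brings the height to -1 and so forces a first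
    passage. Either it is the appended letter itself, or it lies inside \<open>r\<close> and a rest
    \<open>q\<close> of height 1 remains.\<close>
  obtain t v where tv: "r @ [False] = dyck t @ False # v"
    using first_passage_exists[of "r @ [False]"] assms by auto
  show ?thesis
  proof (cases v rule: rev_cases)
    case Nil
    with tv show ?thesis by auto
  next
    case (snoc q x)
    with tv have r: "r = dyck t @ False # q"
      by (metis append_assoc append_Cons butlast_snoc)
    with assms have "height (compl q) < 0" by simp
    then obtain s w where "compl q = w @ False # compl (dyck s)"
      using last_passage_exists by blast
    from arg_cong[OF this, of compl] have "q = compl w @ True # dyck s" by simp
    with r have "r = (dyck t @ False # compl w) @ True # dyck s" by simp
    then show ?thesis by blast
  qed
qed

lemma last_passage_unique:
  "v @ False # compl (dyck s) = w @ False # compl (dyck t) \<longleftrightarrow> s = t \<and> v = w"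
proof
  assume "v @ False # compl (dyck s) = w @ False # compl (dyck t)"
  then have "rev (v @ False # compl (dyck s)) = rev (w @ False # compl (dyck t))"
    by (rule arg_cong)
  then have "dyck (mirror s) @ False # rev v = dyck (mirror t) @ False # rev w"
    by (simp add: dyck_mirror)
  then have "mirror s = mirror t" "v = w"
    by (simp_all add: first_passage_unique)
  then have "rev (compl (dyck s)) = rev (compl (dyck t))"
    by (metis dyck_mirror)
  with \<open>v = w\<close> show "s = t \<and> v = w" by simp
qed auto

section \<open>A path from a Dyck word to its complement\<close>

text \<open>In the middle part, complementing the words on the reversed path of \<open>u\<close> makes it start at
  \<open>dyck u\<close> again.\<close>

primrec path :: "tree \<Rightarrow> bool list list" where
  "path Tip = [[]]"
| "path (Node u b) =
    map (\<lambda>w. True # dyck u @ False # w) (path b) @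
    map (\<lambda>w. False # compl w @ False # compl (dyck b)) (rev (path u)) @
    [False # compl (dyck u) @ True # compl (dyck b)]"

lemma path_not_Nil [simp]: "path t \<noteq> []"
  by (cases t) auto

lemma length_path [simp]: "length (path t) = 2 * size t + 1"
  by (induction t) auto

lemma hd_path [simp]: "hd (path t) = dyck t"
  by (induction t) (auto simp: hd_map)

lemma last_path [simp]: "last (path t) = compl (dyck t)"
  by (cases t) auto

lemma path_NodeE:
  assumes "w \<in> set (path (Node u b))"
  obtains
    (outer) v where "v \<in> set (path b)" "w = True # dyck u @ False # v"
  | (inner) v where "v \<in> set (path u)" "w = False # compl v @ False # compl (dyck b)"
  | (final) "w = False # compl (dyck u) @ True # compl (dyck b)"
  using assms by auto

lemma length_of_path: "w \<in> set (path t) \<Longrightarrow> length w = 2 * size t"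
  by (induction t arbitrary: w) auto

text \<open>Complementing and adding two \<open>False\<close> letters sends height h to -2 - h,
  which swaps 0 and -2 in the inner block.\<close>

lemma height_of_path: "w \<in> set (path t) \<Longrightarrow> height w \<in> {0, -2}"
  by (induction t arbitrary: w) fastforce+

lemma successively_flip_path: "successively flip (path t)"
proof (induction t)
  case Tip
  then show ?case by simp
next
  case (Node u b)
  have "successively (\<lambda>v w. flip (True # dyck u @ False # v) (True # dyck u @ False # w)) (path b)"
    by (rule successively_mono[OF Node.IH(2)]) (intro flip_Cons flip_append_left)
  moreover have "successively (\<lambda>v w. flip (False # compl w @ False # compl (dyck b))
      (False # compl v @ False # compl (dyck b))) (path u)"
    by (rule successively_mono[OF Node.IH(1)])
      (intro flip_Cons flip_append_right flip_compl, rule flip_sym)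
  \<comment> \<open>The two junctions: after \<open>b\<close> is finished the leading
    \<open>True\<close> flips, and after \<open>u\<close> is finished the \<open>False\<close>
    behind it flips.\<close>
  moreover have "flip (True # dyck u @ False # compl (dyck b))
      (False # dyck u @ False # compl (dyck b))"
    using flipI[of "[]" True] by simp
  moreover have "flip (False # compl (dyck u) @ False # compl (dyck b))
      (False # compl (dyck u) @ True # compl (dyck b))"
    using flipI[of "False # compl (dyck u)" False] by simp
  ultimately show ?case
    by (simp add: successively_append_iff successively_map hd_map last_map hd_rev last_rev)
qed

text \<open>If the words agreed, \<open>dyck b'\<close> would have a prefix of negative height.\<close>

lemma inner_neq_final:
  assumes "v \<in> set (path u)"
  shows "compl v @ False # compl (dyck b) \<noteq> compl (dyck u') @ True # compl (dyck b')"
proof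
  assume "compl v @ False # compl (dyck b) = compl (dyck u') @ True # compl (dyck b')"
  then have "compl (v @ True # dyck b) = compl (dyck u' @ False # dyck b')"
    by simp
  then have eq: "v @ True # dyck b = dyck u' @ False # dyck b'"
    by (simp only: compl_eq_iff)
  from arg_cong[OF this, of height] have "height v = -2"
    by simp
  then obtain t v' where v: "v = dyck t @ False # v'"
    using first_passage_exists[of v] by auto
  with eq have b': "dyck b' = v' @ True # dyck b"
    by (simp add: first_passage_unique)
  from v \<open>height v = -2\<close> have "height v' < 0" by simp
  then obtain s v'' where "v' = dyck s @ False # v''"
    using first_passage_exists by blast
  with b' show False
    using dyck_no_passage[of b' s "v'' @ True # dyck b"] by simp
qed

lemma distinct_path: "distinct (path t)"
proof (induction t)
  case Tip
  then show ?case by simp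
next
  case (Node u b)
  then show ?case
    by (auto simp: distinct_map inj_on_def dest: inner_neq_final)
qed

text \<open>The block containing a word reveals one subtree by a first or last passage
  (\<open>u\<close> in the outer block, \<open>b\<close> in the inner one), and induction gives the
  other. In the final block both can be read off.\<close>

lemma path_disjoint:
  "w \<in> set (path s) \<Longrightarrow> w \<in> set (path t) \<Longrightarrow> s = t"
proof (induction s arbitrary: t w)
  case Tip
  then show ?case using length_of_path by (cases t) fastforce+
next
  case (Node u b)
  then obtain u' b' where t: "t = Node u' b'"
    using length_of_path[of w "Node u b"] length_of_path[of w t] by (cases t) auto
  from Node.prems(2) have w: "w \<in> set (path (Node u' b'))" by (simp add: t)
  have "u = u' \<and> b = b'"
    using Node.prems(1)
  proof (cases rule: path_NodeE)
    case (outer v)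
    from w outer show ?thesis
      by (cases rule: path_NodeE) (auto simp: first_passage_unique dest: Node.IH(2))
  next
    case (inner v)
    from w inner show ?thesis
      by (cases rule: path_NodeE)
        (auto simp: last_passage_unique dest: Node.IH(1) inner_neq_final inner_neq_final[OF _ , THEN not_sym])
  next
    case final
    from w show ?thesis
    proof (cases rule: path_NodeE)
      case (outer v)
      with final show ?thesis by simp
    next
      case (inner v)
      with final show ?thesis using inner_neq_final[of v u' b' u b] by simp
    next
      case final': final
      with final have "compl (dyck u @ False # dyck b) = compl (dyck u' @ False # dyck b')"
        by simp
      then show ?thesis by (simp only: compl_eq_iff first_passage_unique dyck_eq_iff)
    qed
  qed
  with t show ?case by simp
qed

lemma path_covers:
  "length w = 2 * k \<Longrightarrow> height w \<in> {0, -2} \<Longrightarrow> \<exists>t. size t = k \<and> w \<in> set (path t)"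
proof (induction k arbitrary: w rule: less_induct)
  case (less k)
  show ?case
  proof (cases w)
    case Nil
    with less.prems have "size Tip = k \<and> w \<in> set (path Tip)" by simp
    then show ?thesis by blast
  next
    case (Cons x v)
    \<comment> \<open>The size of the tree follows from the length of the word, so below it suffices
      to find any tree.\<close>
    have sizes: "\<exists>t. size t = k \<and> w \<in> set (path t)" if "w \<in> set (path t)" for t
      using that length_of_path[OF that] less.prems by auto
    have IH: "\<exists>t. s \<in> set (path t)"
      if "length s < length w" "height s \<in> {0, -2}" "even (length s)" for s
      using less.IH[of "length s div 2" s] that less.prems by auto
    show ?thesis
    proof (cases x)
      case True
      with less.prems Cons obtain u s where v: "v = dyck u @ False # s"
        using first_passage_exists[of v] by auto
      with less.prems Cons True have "height s \<in> {0, -2}" "even (length s)"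
        by (auto, presburger+)
      then obtain b where "s \<in> set (path b)"
        using IH[of s] v Cons by auto
      with v Cons True have "w \<in> set (path (Node u b))" by auto
      then show ?thesis by (rule sizes)
    next
      case False
      \<comment> \<open>Here \<open>s\<close> is the complement of a word on the path of
        \<open>u\<close>, hence the heights 0 and 2.\<close>
      have inner: ?thesis
        if v: "v = s @ False # compl (dyck b)" and h: "height s \<in> {0, 2}" for s b
      proof -
        have "height (compl s) \<in> {0, -2}"
          using h by auto
        moreover have "even (length s)"
          using v less.prems(1) Cons by (simp, presburger)
        ultimately obtain u where "compl s \<in> set (path u)"
          using IH[of "compl s"] v Cons by auto
        then have "w \<in> set (path (Node u b))"
          using v Cons False by (auto intro!: image_eqI[where x = "compl s"])
        then show ?thesis by (rule sizes)
      qed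
      show ?thesis
      proof (cases "height w = 0")
        case False
        with \<open>\<not> x\<close> less.prems Cons have "height v = -1" by simp
        then obtain s b where "v = s @ False # compl (dyck b)"
          using last_passage_exists[of v] by auto
        with \<open>height v = -1\<close> show ?thesis by (intro inner) auto
      next
        case True
        with \<open>\<not> x\<close> Cons have hv: "height v = 1" by simp
        \<comment> \<open>A word of height 0 starting with \<open>False\<close> can be final or
          inner. The candidate for the final shape comes from the first step of \<open>v\<close>
          above level 0; it is correct iff the rest \<open>r\<close> is a Dyck word.\<close>
        then obtain u r where r: "compl v = dyck u @ False # r"
          using first_passage_exists[of "compl v"] by auto
        from arg_cong[OF this, of compl] have v: "v = compl (dyck u) @ True # compl r"
          by simp
        have "height (compl r) = 0" using v hv by simp
        then consider b where "r = dyck b" | s b where "r = s @ True # dyck b"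
          using dyck_or_last_passage[of r] by auto
        then show ?thesis
        proof cases
          case (1 b)
          with v Cons \<open>\<not> x\<close> have "w \<in> set (path (Node u b))" by simp
          then show ?thesis by (rule sizes)
        next
          case (2 s b)
          \<comment> \<open>The last passage inside \<open>r\<close> exposes the
            \<open>False\<close> of the inner shape; the prefix before it has height 2.\<close>
          with v hv have "v = (compl (dyck u) @ True # compl s) @ False # compl (dyck b)"
            "height (compl s) = 1" by simp_all
          then show ?thesis
            by (intro inner[of "compl (dyck u) @ True # compl s" b]) simp_all
        qed
      qed
    qed
  qed
qed

section \<open>From words to sets\<close>

definition word_set :: "bool list \<Rightarrow> nat set" where
  "word_set w = Suc ` {i. i < length w \<and> w ! i}"

lemma word_set_subset: "word_set w \<subseteq> {1..length w}"
  by (auto simp: word_set_def)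

lemma word_set_append: "word_set (v @ w) = word_set v \<union> (+) (length v) ` word_set w"
proof -
  have "{i. i < length (v @ w) \<and> (v @ w) ! i} =
      {i. i < length v \<and> v ! i} \<union> (+) (length v) ` {i. i < length w \<and> w ! i}"
  proof (intro set_eqI iffI)
    fix i assume "i \<in> {i. i < length (v @ w) \<and> (v @ w) ! i}"
    then show "i \<in> {i. i < length v \<and> v ! i} \<union> (+) (length v) ` {i. i < length w \<and> w ! i}"
      by (cases "i < length v")
        (auto simp: nth_append intro!: image_eqI[where x = "i - length v"])
  qed (auto simp: nth_append)
  then show ?thesis
    by (simp add: word_set_def image_Un image_image)
qed

lemma word_set_singleton: "word_set [x] = (if x then {1} else {})"
  by (auto simp: word_set_def)

text \<open>Ones plus zeros give the length, ones minus zeros the height.\<close>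

lemma card_word_set: "2 * int (card (word_set w)) = int (length w) + height w"
proof (induction w rule: rev_induct)
  case Nil
  then show ?case by (simp add: word_set_def)
next
  case (snoc x w)
  have "finite (word_set w)" "Suc (length w) \<notin> word_set w"
    using word_set_subset[of w] by (auto intro: finite_subset)
  with snoc show ?case by (simp add: word_set_append word_set_singleton)
qed

text \<open>Equal lengths matter, since trailing \<open>False\<close> letters leave no trace in the
  set.\<close>

lemma word_set_inj:
  assumes "length v = length w" "word_set v = word_set w"
  shows "v = w"
proof (rule nth_equalityI)
  fix i assume "i < length v"
  then have "Suc i \<in> word_set v \<longleftrightarrow> v ! i" "Suc i \<in> word_set w \<longleftrightarrow> w ! i"
    using assms(1) by (auto simp: word_set_def)
  with assms(2) show "v ! i = w ! i" by simp
qed (rule assms(1))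

lemma word_set_surj:
  assumes "A \<subseteq> {1..n}"
  obtains w where "length w = n" "word_set w = A"
proof
  let ?w = "map (\<lambda>i. Suc i \<in> A) [0..<n]"
  show "length ?w = n" by simp
  show "word_set ?w = A"
  proof (intro set_eqI iffI)
    fix x assume "x \<in> A"
    moreover from this assms have "1 \<le> x" "x \<le> n" by auto
    ultimately show "x \<in> word_set ?w"
      by (auto simp: word_set_def intro!: image_eqI[where x = "x - 1"])
  qed (auto simp: word_set_def)
qed

lemma word_set_flip:
  assumes "flip v w"
  shows "word_set v \<subset> word_set w \<or> word_set w \<subset> word_set v"
proof -
  obtain a x c where eq: "v = a @ [x] @ c" "w = a @ [\<not> x] @ c"
    using assms by (auto simp: flip_def)
  define p where "p = Suc (length a)"
  define B where "B = word_set a \<union> (+) p ` word_set c"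
  \<comment> \<open>The letter at position \<open>p\<close> decides only whether \<open>p\<close>
    itself is added to \<open>B\<close>.\<close>
  have split: "word_set (a @ [y] @ c) = B \<union> (if y then {p} else {})" for y
    unfolding word_set_append word_set_singleton B_def p_def image_Un image_image by auto
  have "p \<notin> B"
    using word_set_subset[of a] word_set_subset[of c] by (auto simp: B_def p_def)
  then show ?thesis
    unfolding eq split by (cases x) auto
qed

lemma word_set_middle_levels:
  assumes "length w = 2 * k + 1"
  shows "word_set w \<in> middle_levels k \<longleftrightarrow> height w \<in> {1, -1}"
  using assms word_set_subset[of w] card_word_set[of w]
  by (auto simp: middle_levels_def)

section \<open>Cycle factors from vertex lists\<close>

text \<open>The tails of a closed walk recover its vertex list; this later yields injectivity, the
  visited vertices and the length.\<close>

lemma map_fst_vwalk_arcs: "map fst (vwalk_arcs (xs @ [x])) = xs"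
  by (induction xs rule: vwalk_arcs.induct) auto

lemma pcas_vwalk_arcs: "xs \<noteq> [] \<Longrightarrow> pcas (hd xs) (vwalk_arcs xs) (last xs)"
  by (induction xs rule: vwalk_arcs.induct) auto

lemma pawalk_verts_vwalk_arcs: "xs \<noteq> [] \<Longrightarrow> pawalk_verts (hd xs) (vwalk_arcs xs) = xs"
  by (induction xs rule: vwalk_arcs.induct) auto

lemma vwalk_arcs_subset_iff:
  "set (vwalk_arcs xs) \<subseteq> R \<longleftrightarrow> successively (\<lambda>x y. (x, y) \<in> R) xs"
  by (induction xs rule: vwalk_arcs.induct) auto

lemma cycle_vwalk_arcs:
  assumes "xs \<noteq> []" "distinct xs" "set xs \<subseteq> pverts G"
    and "successively (\<lambda>x y. (x, y) \<in> parcs G) (xs @ [hd xs])"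
  shows "pre_digraph.cycle (with_proj G) (vwalk_arcs (xs @ [hd xs]))"
proof -
  let ?p = "vwalk_arcs (xs @ [hd xs])"
  have "pcas (hd xs) ?p (hd xs)"
    using pcas_vwalk_arcs[of "xs @ [hd xs]"] assms(1) by simp
  then have "pre_digraph.awalk (with_proj G) (hd xs) ?p (hd xs)"
    using assms by (auto simp: pre_digraph.awalk_def cas_with_proj_eq vwalk_arcs_subset_iff)
  moreover have "pawalk_verts (hd xs) ?p = xs @ [hd xs]"
    using pawalk_verts_vwalk_arcs[of "xs @ [hd xs]"] assms(1) by simp
  \<comment> \<open>Dropping the first vertex of the closed walk leaves a rotation of
    \<open>xs\<close>.\<close>
  then have "distinct (tl (pre_digraph.awalk_verts (with_proj G) (hd xs) ?p))"
    using assms(1,2) by (cases xs) (auto simp: awalk_verts_with_proj_eq)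
  moreover have "?p \<noteq> []"
    using map_fst_vwalk_arcs[of xs "hd xs"] assms(1) by auto
  ultimately show ?thesis
    unfolding pre_digraph.cycle_def by blast
qed

lemma has_cycle_factor_if_vertex_lists:
  assumes "3 \<le> l" "finite L"
    and cyc: "\<And>xs. xs \<in> L \<Longrightarrow> length xs = l \<and> distinct xs \<and>
      successively (\<lambda>x y. (x, y) \<in> parcs G) (xs @ [hd xs])"
    and disj: "\<And>xs ys. xs \<in> L \<Longrightarrow> ys \<in> L \<Longrightarrow> xs \<noteq> ys \<Longrightarrow> set xs \<inter> set ys = {}"
    and cover: "(\<Union>xs\<in>L. set xs) = pverts G"
  shows "has_cycle_factor G l"
proof -
  define arcs where "arcs xs = vwalk_arcs (xs @ [hd xs])" for xs :: "'a list"
  have fst_arcs: "map fst (arcs xs) = xs" for xs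
    by (simp add: arcs_def map_fst_vwalk_arcs)
  then have inj: "inj_on arcs L"
    by (metis inj_onI)
  have set_arcs: "fst ` set (arcs xs) = set xs" for xs
    by (metis fst_arcs list.set_map)
  have len_arcs: "length (arcs xs) = length xs" for xs
    by (metis fst_arcs length_map)
  \<comment> \<open>Counting the disjoint union gives both the divisibility and the number of
    cycles.\<close>
  have "card (pverts G) = (\<Sum>xs\<in>L. card (set xs))"
    unfolding cover[symmetric] using assms(2) disj by (intro card_UN_disjoint) auto
  also have "\<dots> = card L * l"
    using cyc by (simp add: distinct_card)
  finally have card: "card (pverts G) = card L * l" .
  have "is_cycle_factor G l (arcs ` L)"
    unfolding is_cycle_factor_def
  proof (intro conjI ballI impI)
    show "card (arcs ` L) = card (pverts G) div l"
      using card inj \<open>3 \<le> l\<close> by (simp add: card_image)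
    show "pre_digraph.cycle (with_proj G) p" if p: "p \<in> arcs ` L" for p
    proof -
      obtain xs where xs: "xs \<in> L" "p = arcs xs" using p by blast
      show ?thesis
        unfolding xs(2) arcs_def
        using xs(1) cyc[OF xs(1)] cover \<open>3 \<le> l\<close> by (intro cycle_vwalk_arcs) auto
    qed
    show "fst ` set p \<inter> fst ` set q = {}" if pq: "p \<in> arcs ` L" "q \<in> arcs ` L" "p \<noteq> q" for p q
    proof -
      obtain xs ys where "xs \<in> L" "p = arcs xs" "ys \<in> L" "q = arcs ys"
        using pq by blast
      with pq(3) show ?thesis
        using disj[of xs ys] by (auto simp only: set_arcs)
    qed
  qed (use assms card cyc len_arcs in auto)
  then show ?thesis
    by (auto simp: has_cycle_factor_def)
qed

section \<open>The cycle factor\<close>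

definition word_cycle :: "tree \<Rightarrow> bool list list" where
  "word_cycle t =
    map (\<lambda>w. w @ [True]) (path t) @ map (\<lambda>w. compl w @ [False]) (path t)"

lemma word_cycle_not_Nil [simp]: "word_cycle t \<noteq> []"
  by (simp add: word_cycle_def)

lemma length_word_cycle: "length (word_cycle t) = 4 * size t + 2"
  by (simp add: word_cycle_def)

lemma distinct_word_cycle: "distinct (word_cycle t)"
  by (auto simp: word_cycle_def distinct_map distinct_path inj_on_def)

lemma successively_flip_word_cycle:
  "successively flip (word_cycle t @ [hd (word_cycle t)])"
proof -
  have "successively (\<lambda>v w. flip (v @ [True]) (w @ [True])) (path t)"
    by (rule successively_mono[OF successively_flip_path]) (intro flip_append_right)
  moreover have "successively (\<lambda>v w. flip (compl v @ [False]) (compl w @ [False])) (path t)"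
    by (rule successively_mono[OF successively_flip_path]) (intro flip_append_right flip_compl)
  \<comment> \<open>The two halves join by flipping the last letter: the path ends in the word where
    its complement starts, and conversely.\<close>
  moreover have "flip (compl (dyck t) @ [True]) (compl (dyck t) @ [False])"
    using flipI[of "compl (dyck t)" True] by simp
  moreover have "flip (dyck t @ [False]) (dyck t @ [True])"
    using flipI[of "dyck t" False] by simp
  ultimately show ?thesis
    by (simp add: word_cycle_def successively_append_iff successively_map hd_map last_map)
qed

lemma word_cycleE:
  assumes "w \<in> set (word_cycle t)"
  obtains v where "v \<in> set (path t)" "w = v @ [True]"
  | v where "v \<in> set (path t)" "w = compl v @ [False]"
  using assms unfolding word_cycle_def set_append set_map by blast

lemma word_cycle_length_height:
  assumes "w \<in> set (word_cycle t)"
  shows "length w = 2 * size t + 1" "height w \<in> {1, -1}"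
proof -
  have "length w = 2 * size t + 1 \<and> height w \<in> {1, -1}"
    using assms
  proof (cases rule: word_cycleE)
    case (1 v)
    with length_of_path[of v t] height_of_path[of v t] show ?thesis by auto
  next
    case (2 v)
    with length_of_path[of v t] height_of_path[of v t] show ?thesis by auto
  qed
  then show "length w = 2 * size t + 1" "height w \<in> {1, -1}" by blast+
qed

text \<open>The last letter tells which half a word lies in; removing it, and complementing in the
  second half, leaves a word on a path.\<close>

lemma word_cycle_disjoint:
  assumes "w \<in> set (word_cycle s)" "w \<in> set (word_cycle t)"
  shows "s = t"
  using assms(1)
proof (cases rule: word_cycleE)
  case (1 v)
  with assms(2) show ?thesis
    by (auto simp: word_cycle_def intro: path_disjoint)
next
  case (2 v)
  with assms(2) show ?thesis
    by (auto simp: word_cycle_def intro: path_disjoint)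
qed

lemma word_cycle_covers:
  assumes "length w = 2 * k + 1" "height w \<in> {1, -1}"
  shows "\<exists>t. size t = k \<and> w \<in> set (word_cycle t)"
proof (cases w rule: rev_cases)
  case Nil
  with assms show ?thesis by simp
next
  case (snoc v x)
  define u where "u = (if x then v else compl v)"
  have "length u = 2 * k" "height u \<in> {0, -2}"
    using assms snoc by (auto simp: u_def)
  then obtain t where "size t = k" "u \<in> set (path t)"
    using path_covers by blast
  moreover from this have "w \<in> set (word_cycle t)"
    using snoc by (cases x) (force simp: u_def word_cycle_def)+
  ultimately show ?thesis by blast
qed

text \<open>\<open>dyck\<close> embeds these trees into the finitely many words of length
  \<open>2 * k\<close>.\<close>

lemma finite_trees_of_size: "finite {t :: tree. size t = k}"
proof (rule finite_imageD)
  show "finite (dyck ` {t. size t = k})"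
    by (rule finite_subset[OF _ finite_lists_length_eq[of "UNIV :: bool set" "2 * k"]]) auto
qed (auto simp: inj_on_def)

theorem theorem5:
  fixes k :: nat
  assumes "k \<ge> 1"
  shows "has_cycle_factor (middle_levels_graph k) (4 * k + 2)"
proof (rule has_cycle_factor_if_vertex_lists)
  let ?cycle = "\<lambda>t. map word_set (word_cycle t)"
  let ?L = "?cycle ` {t. size t = k}"
  have hd_in: "hd (word_cycle t) \<in> set (word_cycle t)" for t
    by simp
  have vert: "word_set w \<in> middle_levels k" if "w \<in> set (word_cycle t)" "size t = k" for w t
    using word_cycle_length_height[OF that(1)] that(2) by (simp add: word_set_middle_levels)
  show "3 \<le> 4 * k + 2" using assms by simp
  show "finite ?L" by (intro finite_imageI finite_trees_of_size)
  show "length xs = 4 * k + 2 \<and> distinct xs \<and>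
      successively (\<lambda>x y. (x, y) \<in> parcs (middle_levels_graph k)) (xs @ [hd xs])"
    if xs: "xs \<in> ?L" for xs
  proof -
    obtain t where t: "size t = k" "xs = ?cycle t" using xs by blast
    \<comment> \<open>All words of one cycle have the same length, so their sets determine
      them.\<close>
    have "inj_on word_set (set (word_cycle t))"
      by (intro inj_onI word_set_inj) (simp_all add: word_cycle_length_height(1))
    then have "distinct xs"
      by (simp add: t(2) distinct_map distinct_word_cycle)
    moreover have "successively (\<lambda>v w. (word_set v, word_set w) \<in> parcs (middle_levels_graph k))
        (word_cycle t @ [hd (word_cycle t)])"
      by (rule successively_mono[OF successively_flip_word_cycle])
        (use vert[OF _ t(1)] hd_in word_set_flip in \<open>auto simp: middle_levels_graph_def\<close>)
    then have "successively (\<lambda>x y. (x, y) \<in> parcs (middle_levels_graph k))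
        (map word_set (word_cycle t @ [hd (word_cycle t)]))"
      by (simp only: successively_map)
    ultimately show ?thesis
      using t by (simp add: length_word_cycle hd_map)
  qed
  show "set xs \<inter> set ys = {}" if L: "xs \<in> ?L" "ys \<in> ?L" "xs \<noteq> ys" for xs ys
  proof -
    obtain s t where st: "size s = k" "xs = ?cycle s" "size t = k" "ys = ?cycle t"
      using L by blast
    have False if vw: "v \<in> set (word_cycle s)" "w \<in> set (word_cycle t)" "word_set v = word_set w"
      for v w
    proof -
      have "v = w"
        using vw st word_cycle_length_height(1) by (intro word_set_inj) auto
      with vw have "s = t" by (auto dest: word_cycle_disjoint)
      with st \<open>xs \<noteq> ys\<close> show False by simp
    qed
    then show ?thesis unfolding st(2,4) set_map by blast
  qed
  show "(\<Union>xs\<in>?L. set xs) = pverts (middle_levels_graph k)"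
  proof
    show "(\<Union>xs\<in>?L. set xs) \<subseteq> pverts (middle_levels_graph k)"
      using vert by (auto simp: middle_levels_graph_def)
    show "pverts (middle_levels_graph k) \<subseteq> (\<Union>xs\<in>?L. set xs)"
    proof
      fix A assume "A \<in> pverts (middle_levels_graph k)"
      then have A: "A \<in> middle_levels k" by (simp add: middle_levels_graph_def)
      then obtain w where w: "length w = 2 * k + 1" "word_set w = A"
        using word_set_surj[of A "2 * k + 1"] by (auto simp: middle_levels_def)
      with A obtain t where "size t = k" "w \<in> set (word_cycle t)"
        using word_cycle_covers[of w k] by (auto simp: word_set_middle_levels)
      with w show "A \<in> (\<Union>xs\<in>?L. set xs)" by auto
    qed
  qed
qed

end
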